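(* Let $k,k',k''$ be nonnegative integers and let $G$ be a finite simple connected graph of order $n$ and size $m$ with minimum degree $\delta(G)\ge k$. Suppose that $G$ has at least one vertex of degree at least $k'+k''$, set $$\delta^{*}=\min\{\deg(v)\mid v\in V(G)\text{ and }\deg(v)\ge k'+k''\},$$ and suppose $\delta^{*}+k'-k\neq 0$. Then $$\gamma_{(k,k',k'')}(G)\ \ge\ \frac{(k'+\delta^{*})n-2m}{\delta^{*}+k'-k}.$$
   Context: Let $G$ be a finite simple connected graph with vertex set $V=V(G)$; its order is $n=|V(G)|$ and its size is $m=|E(G)|$. For nonnegative integers $k,k',k''$, a set $S\subseteq V$ is a $(k,k',k'')$-dominating set in $G$ if every vertex in $S$ has at least $k$ neighbors in $S$, and every vertex in $V\setminus S$ has at least $k'$ neighbors in $S$ and at least $k''$ neighbors in $V\setminus S$. The $(k,k',k'')$-domination number $\gamma_{(k,k',k'')}(G)$ is the minimum cardinality of a $(k,k',k'')$-dominating set in $G$ (if $\delta(G)\ge k$, such a set exists, since $S=V(G)$ is one). *)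

theory Defs
  imports Complex_Main "Graph_Theory.Digraph_Component"
begin

text \<open>
  Finite simple graphs are the symmetric, loop-free digraphs without parallel arcs of the
  locale \<^locale>\<open>graph\<close>: an undirected edge \<open>{u, v}\<close> is represented by the two arcs from
  \<open>u\<close> to \<open>v\<close> and from \<open>v\<close> to \<open>u\<close>.
\<close>

definition neighborhood :: "('a, 'b) pre_digraph \<Rightarrow> 'a \<Rightarrow> 'a set" where
  "neighborhood G v = {u \<in> verts G. v \<rightarrow>\<^bsub>G\<^esub> u}"

definition vertex_degree :: "('a, 'b) pre_digraph \<Rightarrow> 'a \<Rightarrow> nat" where
  "vertex_degree G v = card (neighborhood G v)"

text \<open>Edges are unordered, so that the two arcs of an undirected edge are counted once.\<close>

definition undirected_edges :: "('a, 'b) pre_digraph \<Rightarrow> 'a set set" where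
  "undirected_edges G = (\<lambda>e. {tail G e, head G e}) ` arcs G"

definition graph_order :: "('a, 'b) pre_digraph \<Rightarrow> nat" where
  "graph_order G = card (verts G)"

definition graph_size :: "('a, 'b) pre_digraph \<Rightarrow> nat" where
  "graph_size G = card (undirected_edges G)"

definition min_degree :: "('a, 'b) pre_digraph \<Rightarrow> nat" where
  "min_degree G = Min (vertex_degree G ` verts G)"

definition dominating_set ::
    "('a, 'b) pre_digraph \<Rightarrow> nat \<Rightarrow> nat \<Rightarrow> nat \<Rightarrow> 'a set \<Rightarrow> bool" where
  "dominating_set G k k' k'' S \<longleftrightarrow>
     S \<subseteq> verts G \<and>
     (\<forall>v\<in>S. k \<le> card (neighborhood G v \<inter> S)) \<and>
     (\<forall>v\<in>verts G - S. k' \<le> card (neighborhood G v \<inter> S) \<and>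
                      k'' \<le> card (neighborhood G v \<inter> (verts G - S)))"

text \<open>
  The minimum ranges over a nonempty set whenever \<open>k \<le> min_degree G\<close>, as \<open>verts G\<close> itself
  is then dominating; without a dominating set the value is unspecified.
\<close>

definition domination_number :: "('a, 'b) pre_digraph \<Rightarrow> nat \<Rightarrow> nat \<Rightarrow> nat \<Rightarrow> nat" where
  "domination_number G k k' k'' = Min {card S | S. dominating_set G k k' k'' S}"

text \<open>Unspecified if \<open>G\<close> has no vertex of degree at least \<open>d\<close>.\<close>

definition min_degree_at_least :: "('a, 'b) pre_digraph \<Rightarrow> nat \<Rightarrow> nat" where
  "min_degree_at_least G d = Min {vertex_degree G v | v. v \<in> verts G \<and> d \<le> vertex_degree G v}"

end

theory Submission
  imports Defs
begin

text \<open>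
  The bound comes from counting the degree sum \<open>2m\<close> in two parts, inside a minimum dominating
  set \<open>S\<close> and outside it. A vertex outside \<open>S\<close> has at least \<open>k'\<close> neighbours in \<open>S\<close> and at least
  \<open>k''\<close> outside, so its degree is one of those over which \<open>\<delta>\<^sup>*\<close> is the minimum; the outer part is
  therefore at least \<open>\<delta>\<^sup>* (n - |S|)\<close>. The inner part consists of the degrees inside \<open>S\<close>, which
  contribute at least \<open>k |S|\<close>, and of the edges leaving \<open>S\<close>. Counted from their outer ends
  (\<open>cut_degree_sum\<close>), the latter number at least \<open>k' (n - |S|)\<close>. Together with the handshake
  identity (\<open>handshake\<close>) this gives
  \<open>2m \<ge> k |S| + (k' + \<delta>\<^sup>*) (n - |S|)\<close> for every dominating set \<open>S\<close>.

  Solving for \<open>|S|\<close> divides by \<open>\<delta>\<^sup>* + k' - k\<close>, which has the right sign: \<open>\<delta>\<^sup>*\<close> is itself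
  a degree, hence at least \<open>k\<close>, and the divisor was supposed to be nonzero.
\<close>

context graph
begin

lemma finite_neighborhood: "finite (neighborhood G v)"
  unfolding neighborhood_def by simp

lemma neighborhood_subset: "neighborhood G v \<subseteq> verts G"
  unfolding neighborhood_def by auto

lemma neighborhood_commute:
  assumes "u \<in> verts G" "v \<in> verts G"
  shows "u \<in> neighborhood G v \<longleftrightarrow> v \<in> neighborhood G u"
  using assms graph_symmetric unfolding neighborhood_def by auto

lemma undirected_edges_eq: "undirected_edges G = {{u, v} |u v. u \<rightarrow>\<^bsub>G\<^esub> v}"
  unfolding undirected_edges_def arcs_ends_def arc_to_ends_def by auto

lemma card_undirected_edge:
  assumes "e \<in> undirected_edges G"
  shows "e \<subseteq> verts G" "card e = 2"
proof -
  obtain u v where uv: "e = {u, v}" "u \<rightarrow>\<^bsub>G\<^esub> v"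
    using assms unfolding undirected_edges_eq by auto
  then have "u \<noteq> v"
    using adj_not_same by auto
  with uv show "e \<subseteq> verts G" "card e = 2"
    using adj_in_verts by auto
qed

text \<open>
  Simplicity makes edges at \<open>v\<close> and neighbours of \<open>v\<close> the same data: a neighbour \<open>u\<close>
  determines the edge \<open>{v, u}\<close>, and conversely.
\<close>

lemma vertex_degree_eq_card_incident:
  "vertex_degree G v = card {e \<in> undirected_edges G. v \<in> e}"
proof -
  have "{e \<in> undirected_edges G. v \<in> e} = (\<lambda>u. {v, u}) ` neighborhood G v"
    unfolding undirected_edges_eq neighborhood_def
    using graph_symmetric adj_in_verts by (auto simp: insert_commute)
  moreover have "inj_on (\<lambda>u. {v, u}) (neighborhood G v)"
    by (auto simp: inj_on_def doubleton_eq_iff)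
  ultimately show ?thesis
    unfolding vertex_degree_def by (simp add: card_image)
qed

lemma handshake: "(\<Sum>v\<in>verts G. vertex_degree G v) = 2 * graph_size G"
proof -
  have two_ends: "card {v \<in> verts G. v \<in> e} = 2" if "e \<in> undirected_edges G" for e
  proof -
    have "{v \<in> verts G. v \<in> e} = e"
      using card_undirected_edge(1)[OF that] by auto
    then show ?thesis
      using card_undirected_edge(2)[OF that] by simp
  qed
  have "finite (undirected_edges G)"
    unfolding undirected_edges_def by simp
  then have "(\<Sum>v\<in>verts G. card {e \<in> undirected_edges G. v \<in> e}) = 2 * card (undirected_edges G)"
    using two_ends by (intro sum_multicount) auto
  then show ?thesis
    unfolding graph_size_def vertex_degree_eq_card_incident .
qed

text \<open>Both sides count the edges between \<open>S\<close> and \<open>T\<close>, each from one of its two ends.\<close>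

lemma cut_degree_sum:
  assumes "S \<subseteq> verts G" "T \<subseteq> verts G"
  shows "(\<Sum>v\<in>S. card (neighborhood G v \<inter> T)) = (\<Sum>v\<in>T. card (neighborhood G v \<inter> S))"
proof -
  have "finite S" "finite T"
    using assms finite_verts by (auto intro: finite_subset)
  then have "(\<Sum>v\<in>S. card {u \<in> T. u \<in> neighborhood G v}) = (\<Sum>u\<in>T. card (neighborhood G u \<inter> S))"
  proof (rule sum_multicount_gen, intro ballI)
    fix u assume "u \<in> T"
    then have "{v \<in> S. u \<in> neighborhood G v} = neighborhood G u \<inter> S"
      using assms neighborhood_commute[of u] by blast
    then show "card {v \<in> S. u \<in> neighborhood G v} = card (neighborhood G u \<inter> S)"
      by simp
  qed
  moreover have "{u \<in> T. u \<in> neighborhood G v} = neighborhood G v \<inter> T" for v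
    by auto
  ultimately show ?thesis
    by simp
qed

lemma vertex_degree_split:
  assumes "S \<subseteq> verts G"
  shows "vertex_degree G v =
    card (neighborhood G v \<inter> S) + card (neighborhood G v \<inter> (verts G - S))"
proof -
  have "neighborhood G v = (neighborhood G v \<inter> S) \<union> (neighborhood G v \<inter> (verts G - S))"
    using neighborhood_subset by blast
  moreover have "card \<dots> = card (neighborhood G v \<inter> S) + card (neighborhood G v \<inter> (verts G - S))"
    using finite_neighborhood by (intro card_Un_disjoint) auto
  ultimately show ?thesis
    unfolding vertex_degree_def by simp
qed

lemma min_degree_le: "v \<in> verts G \<Longrightarrow> min_degree G \<le> vertex_degree G v"
  unfolding min_degree_def by simp

lemma min_degree_at_least_le:
  assumes "v \<in> verts G" "d \<le> vertex_degree G v"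
  shows "min_degree_at_least G d \<le> vertex_degree G v"
  unfolding min_degree_at_least_def using assms by (intro Min_le) auto

lemma min_degree_at_least_attained:
  assumes "\<exists>v\<in>verts G. d \<le> vertex_degree G v"
  shows "\<exists>v\<in>verts G. vertex_degree G v = min_degree_at_least G d"
proof -
  have "min_degree_at_least G d \<in> {vertex_degree G v | v. v \<in> verts G \<and> d \<le> vertex_degree G v}"
    unfolding min_degree_at_least_def using assms by (intro Min_in) auto
  then show ?thesis
    by auto
qed

lemma dominating_set_verts:
  assumes "k \<le> min_degree G"
  shows "dominating_set G k k' k'' (verts G)"
  unfolding dominating_set_def
  using assms min_degree_le neighborhood_subset
  by (fastforce simp: vertex_degree_def Int_absorb2 dest: order_trans)

lemma domination_number_attained:
  assumes "k \<le> min_degree G"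
  obtains S where "dominating_set G k k' k'' S" "card S = domination_number G k k' k''"
proof -
  have "finite {S. dominating_set G k k' k'' S}"
    by (rule finite_subset[of _ "Pow (verts G)"]) (auto simp: dominating_set_def)
  then have "domination_number G k k' k'' \<in> {card S | S. dominating_set G k k' k'' S}"
    unfolding domination_number_def
    using dominating_set_verts[OF assms] by (intro Min_in) auto
  then show thesis
    using that by auto
qed

text \<open>
  The term \<open>k' * card (verts G - S)\<close> bounds the edges between \<open>S\<close> and its complement as seen from
  inside \<open>S\<close>. The same edges occur a second time among the degrees outside \<open>S\<close>, which are
  bounded as a whole by \<open>min_degree_at_least\<close>; this is why both coefficients appear.
\<close>

lemma dominating_set_degree_bound:
  assumes dom: "dominating_set G k k' k'' S"
  shows "k * card S + (k' + min_degree_at_least G (k' + k'')) * card (verts G - S)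
    \<le> 2 * graph_size G"
proof -
  define T where "T = verts G - S"
  define d where "d = min_degree_at_least G (k' + k'')"
  have S: "S \<subseteq> verts G" and T: "T \<subseteq> verts G"
    and inner: "\<And>v. v \<in> S \<Longrightarrow> k \<le> card (neighborhood G v \<inter> S)"
    and outer: "\<And>v. v \<in> T \<Longrightarrow> k' \<le> card (neighborhood G v \<inter> S)"
      "\<And>v. v \<in> T \<Longrightarrow> k'' \<le> card (neighborhood G v \<inter> T)"
    using dom unfolding dominating_set_def T_def by auto
  have split: "vertex_degree G v = card (neighborhood G v \<inter> S) + card (neighborhood G v \<inter> T)" for v
    unfolding T_def by (rule vertex_degree_split[OF S])
  have outer_degree: "d \<le> vertex_degree G v" if "v \<in> T" for v
    unfolding d_def using that T outer[OF that] split[of v] by (intro min_degree_at_least_le) auto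
  have "k * card S \<le> (\<Sum>v\<in>S. card (neighborhood G v \<inter> S))"
    using sum_bounded_below[of S k "\<lambda>v. card (neighborhood G v \<inter> S)"] inner
    by (simp add: mult.commute)
  moreover have "k' * card T \<le> (\<Sum>v\<in>S. card (neighborhood G v \<inter> T))"
    unfolding cut_degree_sum[OF S T]
    using sum_bounded_below[of T k' "\<lambda>v. card (neighborhood G v \<inter> S)"] outer(1)
    by (simp add: mult.commute)
  moreover have "d * card T \<le> (\<Sum>v\<in>T. vertex_degree G v)"
    using sum_bounded_below[of T d "vertex_degree G"] outer_degree by (simp add: mult.commute)
  moreover have "(\<Sum>v\<in>verts G. vertex_degree G v) =
      (\<Sum>v\<in>S. card (neighborhood G v \<inter> S)) + (\<Sum>v\<in>S. card (neighborhood G v \<inter> T))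
        + (\<Sum>v\<in>T. vertex_degree G v)"
  proof -
    have "(\<Sum>v\<in>verts G. vertex_degree G v) = (\<Sum>v\<in>S. vertex_degree G v) + (\<Sum>v\<in>T. vertex_degree G v)"
      unfolding T_def using sum.subset_diff[OF S finite_verts, of "vertex_degree G"] by simp
    then show ?thesis
      by (simp add: split sum.distrib)
  qed
  ultimately show ?thesis
    unfolding T_def[symmetric] d_def[symmetric] handshake[symmetric]
    by (simp add: add_mult_distrib)
qed

end

theorem theorem2p3:
  fixes G :: "('a, 'b) pre_digraph" and k k' k'' \<delta>' :: nat
  assumes "graph G" and "Digraph_Component.connected G"
    and "min_degree G \<ge> k"
    and "\<exists>v\<in>verts G. vertex_degree G v \<ge> k' + k''"
    and "\<delta>' = min_degree_at_least G (k' + k'')"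
    and "real \<delta>' + real k' - real k \<noteq> 0"
  shows "real (domination_number G k k' k'') \<ge>
    ((real k' + real \<delta>') * real (graph_order G) - 2 * real (graph_size G))
      / (real \<delta>' + real k' - real k)"
proof -
  interpret graph G by fact
  obtain S where dom: "dominating_set G k k' k'' S"
    and card_S: "card S = domination_number G k k' k''"
    using domination_number_attained[OF assms(3)] .
  have S: "S \<subseteq> verts G"
    using dom unfolding dominating_set_def by simp
  have "k \<le> \<delta>'"
    using min_degree_at_least_attained[OF assms(4)] assms(3,5) min_degree_le
    by (metis order_trans)
  then have pos: "0 < real \<delta>' + real k' - real k"
    using assms(6) by linarith
  have card_outer: "real (card (verts G - S)) = real (graph_order G) - real (card S)"
    unfolding graph_order_def using S finite_verts
    by (simp add: card_Diff_subset finite_subset card_mono of_nat_diff)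
  have "real k * real (card S) + (real k' + real \<delta>') * real (card (verts G - S))
      \<le> 2 * real (graph_size G)"
    using dominating_set_degree_bound[OF dom] unfolding assms(5)[symmetric]
    by (metis of_nat_add of_nat_le_iff of_nat_mult of_nat_numeral)
  then have "(real k' + real \<delta>') * real (graph_order G) - 2 * real (graph_size G)
      \<le> real (card S) * (real \<delta>' + real k' - real k)"
    unfolding card_outer by (simp add: algebra_simps)
  then show ?thesis
    unfolding card_S using pos by (simp add: pos_divide_le_eq)
qed

end
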